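(* Let $\varepsilon>0$ be a real number and let $(n_k)_{k\ge 0}$ be a strictly increasing sequence of positive integers with $n_0=1$. Then the following assertions are equivalent: (i) $(A,(n_k)_{k\ge 0},\varepsilon)$ is NSS for any complex (unital) normed algebra $A$; (ii) $(\mathbb{C},(n_k)_{k\ge 0},\varepsilon)$ is NSS; (iii) $((n_k)_{k\ge 0},\varepsilon)$ is a Jamison pair and $\varepsilon\le 1$.
   Context: A unital normed algebra $A$ with unit $e$ satisfies $\|e\|=1$ and $\|xy\|\le\|x\|\,\|y\|$ for all $x,y\in A$. The algebra $\mathbb{C}$ carries the usual absolute value as norm. For a unital normed algebra $A$ with unit $e$, a strictly increasing sequence $(n_k)_{k\ge 0}$ of positive integers with $n_0=1$, and $\varepsilon>0$, the triplet $(A,(n_k)_{k\ge 0},\varepsilon)$ is NSS if the only element $a\in A$ satisfying $\sup_{k\ge 0}\|a^{n_k}-e\|<\varepsilon$ is $a=e$. $((n_k)_{k\ge 0},\varepsilon)$ is a Jamison pair if for every $\lambda\in\mathbb{C}$ with $|\lambda|=1$ and $\lambda\ne 1$ one has $\sup_{k\ge 0}|\lambda^{n_k}-1|\ge\varepsilon$. *)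

theory Defs
  imports "HOL-Analysis.Analysis" "HOL-Algebra.Module"
begin

definition complex_ring :: "complex ring" where
  "complex_ring =
     \<lparr>carrier = UNIV, mult = (*), one = 1, zero = 0, add = (+)\<rparr>"

record 'a normed_algebra = "(complex, 'a) module" +
  alg_norm :: "'a \<Rightarrow> real"

text \<open>
  The locale \<open>algebra\<close> of HOL-Algebra requires a commutative multiplication and is
  therefore not used here. The type \<open>'a\<close> only serves as a universe in which the underlying
  set of the algebra lives; the algebra itself is \<open>carrier A\<close>.
\<close>

locale complex_normed_algebra = ring A + Module.module complex_ring A
  for A :: "('a, 'm) normed_algebra_scheme" (structure) +
  assumes smult_mult_left:
      "\<lbrakk>x \<in> carrier A; y \<in> carrier A\<rbrakk> \<Longrightarrow> (c \<odot>\<^bsub>A\<^esub> x) \<otimes> y = c \<odot>\<^bsub>A\<^esub> (x \<otimes> y)"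
    and smult_mult_right:
      "\<lbrakk>x \<in> carrier A; y \<in> carrier A\<rbrakk> \<Longrightarrow> x \<otimes> (c \<odot>\<^bsub>A\<^esub> y) = c \<odot>\<^bsub>A\<^esub> (x \<otimes> y)"
    and norm_nonneg: "x \<in> carrier A \<Longrightarrow> 0 \<le> alg_norm A x"
    and norm_eq_zero_iff: "x \<in> carrier A \<Longrightarrow> alg_norm A x = 0 \<longleftrightarrow> x = \<zero>"
    and norm_smult: "x \<in> carrier A \<Longrightarrow> alg_norm A (c \<odot>\<^bsub>A\<^esub> x) = cmod c * alg_norm A x"
    and norm_triangle:
      "\<lbrakk>x \<in> carrier A; y \<in> carrier A\<rbrakk> \<Longrightarrow> alg_norm A (x \<oplus> y) \<le> alg_norm A x + alg_norm A y"
    and norm_submult: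
      "\<lbrakk>x \<in> carrier A; y \<in> carrier A\<rbrakk> \<Longrightarrow> alg_norm A (x \<otimes> y) \<le> alg_norm A x * alg_norm A y"
    and norm_unit: "alg_norm A \<one> = 1"

definition complex_algebra :: "complex normed_algebra" where
  "complex_algebra =
     \<lparr>carrier = UNIV, mult = (*), one = 1, zero = 0, add = (+),
      smult = (*), alg_norm = cmod\<rparr>"

lemma cring_complex_ring: "cring complex_ring"
  by (rule cringI; (rule abelian_groupI comm_monoidI)?)
     (auto simp: complex_ring_def algebra_simps intro: exI[of _ "- x" for x])

lemma complex_normed_algebra_complex_algebra: "complex_normed_algebra complex_algebra"
proof -
  have ab: "abelian_group complex_algebra"
    by (rule abelian_groupI)
       (auto simp: complex_algebra_def algebra_simps intro: exI[of _ "- x" for x])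
  have rg: "ring complex_algebra"
    by (rule ringI[OF ab]; (rule monoidI)?) (auto simp: complex_algebra_def algebra_simps)
  have md: "Module.module complex_ring complex_algebra"
    by (rule moduleI[OF cring_complex_ring ab])
       (auto simp: complex_algebra_def complex_ring_def algebra_simps)
  show ?thesis
    by (intro complex_normed_algebra.intro rg md complex_normed_algebra_axioms.intro)
       (auto simp: complex_algebra_def norm_mult norm_triangle_ineq)
qed

text \<open>
  The supremum is taken in the extended reals, since for \<open>\<parallel>a\<parallel> > 1\<close> the sequence
  of norms is in general unbounded.
\<close>

definition NSS :: "('a, 'm) normed_algebra_scheme \<Rightarrow> (nat \<Rightarrow> nat) \<Rightarrow> real \<Rightarrow> bool" where
  "NSS A n \<epsilon> \<longleftrightarrow>
     {a \<in> carrier A.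
        (SUP k. ereal (alg_norm A (a [^]\<^bsub>A\<^esub> n k \<ominus>\<^bsub>A\<^esub> \<one>\<^bsub>A\<^esub>))) < ereal \<epsilon>} = {\<one>\<^bsub>A\<^esub>}"

definition Jamison_pair :: "(nat \<Rightarrow> nat) \<Rightarrow> real \<Rightarrow> bool" where
  "Jamison_pair n \<epsilon> \<longleftrightarrow>
     (\<forall>z::complex. cmod z = 1 \<and> z \<noteq> 1 \<longrightarrow>
        (SUP k. ereal (cmod (z ^ n k - 1))) \<ge> ereal \<epsilon>)"

text \<open>
  \<open>all_complex_NSS TYPE('a)\<close> quantifies over all complex unital normed algebras whose
  underlying set is a subset of the universe \<open>'a\<close>. HOL cannot quantify over types inside a
  formula. Every such algebra contains a copy of the complex field, so a type
  \<open>'a\<close> accommodates some algebra only if the complex numbers inject into it.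
\<close>

definition all_complex_NSS :: "'a itself \<Rightarrow> (nat \<Rightarrow> nat) \<Rightarrow> real \<Rightarrow> bool" where
  "all_complex_NSS _ n \<epsilon> \<longleftrightarrow>
     (\<forall>A :: 'a normed_algebra. complex_normed_algebra A \<longrightarrow> NSS A n \<epsilon>)"

end

theory Submission
  imports Defs
begin

text \<open>
  The substantial implication is from the scalars to an arbitrary normed algebra. Let \<open>a\<close> satisfy
  \<open>\<parallel>a\<^bsup>n k\<^esup> - e\<parallel> \<le> r < \<epsilon> \<le> 1\<close> for all \<open>k\<close>, and put \<open>q = a - e\<close>. Every approximate
  eigenvalue \<open>\<lambda>\<close> of \<open>a\<close> satisfies \<open>cmod (\<lambda>\<^bsup>n k\<^esup> - 1) \<le> r\<close> for all \<open>k\<close>, so that the NSS property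
  of the scalars forces \<open>\<lambda> = 1\<close>: the only possible approximate eigenvalue of \<open>q\<close> is \<open>0\<close>
  (\<open>approx_eigenvalue_bound\<close>). It follows that \<open>q\<close> is quasinilpotent (\<open>quasinilpotent\<close>), as in
  the classical theory where the boundary of the spectrum consists of approximate eigenvalues.

  For quasinilpotent \<open>q\<close>, the element \<open>e + q\<close> is the principal \<open>m\<close>-th root of
  \<open>(e + q)\<^sup>m = e + Q\<close>, and for \<open>\<parallel>Q\<parallel> \<le> r < 1\<close> this root is given by the binomial series in \<open>Q\<close>.
  The coefficients of the series after the constant one are at most \<open>1 / m\<close> in modulus, so that
  \<open>\<parallel>q\<parallel> \<le> 1 / (m (1 - r))\<close> (\<open>root_bound\<close>). The choice \<open>m = n k\<close> and \<open>k \<longlonglongrightarrow> \<infinity>\<close> yields \<open>q = 0\<close>.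

  Since the algebra need not be complete, neither resolvents nor series are formed in it. The
  polynomials in \<open>q\<close> are treated as elements of \<open>complex poly\<close> with the seminorm
  \<open>p \<mapsto> \<parallel>p(q)\<parallel>\<close>; lower bounds for multiplication operators stand in for resolvents, and truncated
  formal power series for convergent ones.

  Among the scalars, the Jamison property concerns the unit circle only. The condition
  \<open>\<epsilon> \<le> 1\<close> takes care of all other scalars, and it is necessary because of the scalar \<open>0\<close>.
  Finally, the universal statement about algebras in a type specialises to the complex field because
  the field can be copied into that type.
\<close>

section \<open>Approximate eigenvalues and quasinilpotence\<close>

text \<open>
  Everything about a single element \<open>q\<close> of a normed algebra is recorded by the seminorm
  \<open>p \<mapsto> \<parallel>p(q)\<parallel>\<close> on polynomials: the generator \<open>[:0, 1:]\<close> stands for \<open>q\<close>. Working with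
  the seminorm replaces a carrier-based algebra by the commutative ring \<open>complex poly\<close>, and
  inequalities between norms of polynomials replace inverses, so that no completion is needed.
\<close>

locale algebra_seminorm =
  fixes N :: "complex poly \<Rightarrow> real"
  assumes triangle: "N (p + q) \<le> N p + N q"
    and scale: "N (Polynomial.smult c p) = cmod c * N p"
    and submult: "N (p * q) \<le> N p * N q"
    and one: "N 1 = 1"
begin

lemma zero: "N 0 = 0"
  using scale[of 0 0] by simp

lemma minus: "N (- p) = N p"
  using scale[of "-1" p] by simp

lemma diff: "N (p - q) \<le> N p + N q"
  using triangle[of p "- q"] minus[of q] by simp

lemma diff_commute: "N (p - q) = N (q - p)"
  using minus[of "p - q"] by simp

lemma nonneg: "0 \<le> N p"
  using diff[of p p] zero by simp

lemma triangle_le_diff: "N p \<le> N q + N (p - q)"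
  using triangle[of q "p - q"] by simp

lemma sum_le: "N (\<Sum>i\<in>S. f i) \<le> (\<Sum>i\<in>S. N (f i))"
proof (induction S rule: infinite_finite_induct)
  case (insert x F)
  then show ?case
    using triangle[of "f x" "\<Sum>i\<in>F. f i"] by simp
qed (auto simp: zero)

lemma power_le: "N (p ^ m) \<le> N p ^ m"
proof (induction m)
  case (Suc m)
  have "N (p ^ Suc m) \<le> N p * N (p ^ m)"
    using submult[of p "p ^ m"] by simp
  also have "\<dots> \<le> N p ^ Suc m"
    using Suc nonneg[of p] by (simp add: mult_left_mono)
  finally show ?case .
qed (simp add: one)

text \<open>
  In place of the spectrum: the scalars \<open>\<mu>\<close> for which \<open>q - \<mu>\<close> is a topological divisor of zero
  on the subalgebra generated by \<open>q\<close>. For such \<open>\<mu>\<close> the element \<open>q - \<mu>\<close> stays singular in every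
  larger normed algebra, in particular in the completion.
\<close>

definition approx_eigenvalue :: "complex \<Rightarrow> bool" where
  "approx_eigenvalue \<mu> \<longleftrightarrow> (\<forall>\<delta>>0. \<exists>p. N ([:- \<mu>, 1:] * p) < \<delta> * N p)"

text \<open>
  An approximate eigenvector of \<open>q\<close> for \<open>\<mu>\<close> is one of \<open>(1 + q)\<^sup>m - 1\<close> for
  \<open>(1 + \<mu>)\<^sup>m - 1\<close>, because \<open>q - \<mu>\<close> divides the difference of the powers; and an approximate
  eigenvalue has modulus at most the norm. This is how an NSS property of the scalars acts on the algebra.
\<close>

lemma approx_eigenvalue_bound:
  assumes "approx_eigenvalue \<mu>"
  shows "cmod ((1 + \<mu>) ^ m - 1) \<le> N ([:1, 1:] ^ m - 1)"
proof (rule field_le_epsilon)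
  fix e :: real
  assume e: "0 < e"
  define S where "S = (\<Sum>i<m. [:1 + \<mu>:] ^ (m - Suc i) * [:1, 1:] ^ i)"
  have fact: "[:1, 1:] ^ m - [:(1 + \<mu>) ^ m:] = [:- \<mu>, 1:] * S"
    using power_diff_sumr2[of "[:1, 1:]" m "[:1 + \<mu>:]"] by (simp add: S_def poly_const_pow)
  have S0: "0 \<le> N S" by (rule nonneg)
  have "0 < e / (N S + 1)" using e S0 by simp
  then obtain p where p: "N ([:- \<mu>, 1:] * p) < e / (N S + 1) * N p"
    using assms unfolding approx_eigenvalue_def by blast
  have p0: "N p > 0"
    using p nonneg[of "[:- \<mu>, 1:] * p"] nonneg[of p] by (cases "N p = 0") auto
  have "Polynomial.smult ((1 + \<mu>) ^ m - 1) p = ([:1, 1:] ^ m - 1) * p - S * ([:- \<mu>, 1:] * p)"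
  proof -
    have "S * ([:- \<mu>, 1:] * p) = ([:1, 1:] ^ m - [:(1 + \<mu>) ^ m:]) * p"
      unfolding fact by (simp only: mult_ac)
    then show ?thesis
      by (simp add: algebra_simps smult_diff_left)
  qed
  then have "cmod ((1 + \<mu>) ^ m - 1) * N p \<le> N (([:1, 1:] ^ m - 1) * p) + N (S * ([:- \<mu>, 1:] * p))"
    using diff scale by metis
  also have "\<dots> \<le> N ([:1, 1:] ^ m - 1) * N p + N S * N ([:- \<mu>, 1:] * p)"
    by (intro add_mono submult)
  also have "N S * N ([:- \<mu>, 1:] * p) \<le> N S * (e / (N S + 1) * N p)"
    using p S0 by (intro mult_left_mono) auto
  also have "\<dots> \<le> e * N p"
    using S0 e p0 by (simp add: field_simps)
  finally have "cmod ((1 + \<mu>) ^ m - 1) * N p \<le> (N ([:1, 1:] ^ m - 1) + e) * N p"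
    by (simp add: algebra_simps)
  then show "cmod ((1 + \<mu>) ^ m - 1) \<le> N ([:1, 1:] ^ m - 1) + e"
    using p0 by simp
qed

text \<open>
  The reciprocal variable \<open>z = 1 / \<mu>\<close> turns the complement of \<open>0\<close> into a union of compact discs
  \<open>cmod z \<le> R\<close>, with the harmless factor \<open>1\<close> at \<open>z = 0\<close>. The best lower bound
  for \<open>1 - z q\<close> depends continuously on \<open>z\<close>, so that bounds at the single points give a uniform
  one on the disc.
\<close>

lemma uniform_lower_bound:
  assumes spec: "\<And>\<mu>. approx_eigenvalue \<mu> \<Longrightarrow> \<mu> = 0"
  shows "\<exists>\<delta>>0. \<forall>z p. cmod z \<le> R \<longrightarrow> \<delta> * N p \<le> N ([:1, - z:] * p)"
proof (rule ccontr)
  assume neg: "\<not> ?thesis"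
  have "\<exists>z p. cmod z \<le> R \<and> N ([:1, - z:] * p) < inverse (real (Suc k)) * N p" for k
    using neg by (metis inverse_positive_iff_positive not_le of_nat_0_less_iff zero_less_Suc)
  then obtain z p where zp: "\<And>k. cmod (z k) \<le> R"
      "\<And>k. N ([:1, - z k:] * p k) < inverse (real (Suc k)) * N (p k)"
    by metis
  have "seq_compact (cball (0::complex) R)"
    using compact_cball compact_imp_seq_compact by blast
  then obtain l r where r: "strict_mono r" "(z \<circ> r) \<longlonglongrightarrow> l"
    using zp(1) by (auto simp: seq_compact_def) (metis dist_0_norm mem_cball)
  \<comment> \<open>The bound at the limit point of bad parameters contradicts their badness.\<close>
  have "\<exists>d>0. \<forall>p. d * N p \<le> N ([:1, - l:] * p)"
  proof (cases "l = 0")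
    case True
    then show ?thesis by (intro exI[of _ 1]) simp
  next
    case False
    then have "\<not> approx_eigenvalue (inverse l)"
      using spec by fastforce
    then obtain d where d: "d > 0" "\<And>p. d * N p \<le> N ([:- inverse l, 1:] * p)"
      unfolding approx_eigenvalue_def by (meson not_less)
    have "[:1, - l:] * p = Polynomial.smult (- l) ([:- inverse l, 1:] * p)" for p
    proof -
      have "[:1, - l:] = Polynomial.smult (- l) [:- inverse l, 1:]" using False by simp
      then show ?thesis by (metis mult_smult_left)
    qed
    then have "(cmod l * d) * N p \<le> N ([:1, - l:] * p)" for p
      using d(2)[of p] scale[of "- l"] by (simp add: mult_left_mono mult.assoc del: mult_pCons_left)
    then show ?thesis
      using d(1) False by (metis mult_pos_pos zero_less_norm_iff)
  qed
  then obtain d where d: "d > 0" "\<And>p. d * N p \<le> N ([:1, - l:] * p)" by blast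
  have "(\<lambda>k. inverse (real (Suc (r k))) + cmod (z (r k) - l) * N [:0, 1:]) \<longlonglongrightarrow> 0 + 0 * N [:0, 1:]"
  proof (intro tendsto_intros)
    show "(\<lambda>k. inverse (real (Suc (r k)))) \<longlonglongrightarrow> 0"
      using LIMSEQ_subseq_LIMSEQ[OF LIMSEQ_inverse_real_of_nat r(1)] by (simp add: o_def)
    show "(\<lambda>k. cmod (z (r k) - l)) \<longlonglongrightarrow> 0"
      using r(2) by (simp add: o_def tendsto_norm_zero LIM_zero)
  qed
  then have "eventually (\<lambda>k. inverse (real (Suc (r k))) + cmod (z (r k) - l) * N [:0, 1:] < d) sequentially"
    using d(1) by (simp add: order_tendsto_iff)
  then obtain k where k: "inverse (real (Suc (r k))) + cmod (z (r k) - l) * N [:0, 1:] < d"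
    by (meson eventually_sequentially le_refl)
  define w q where "w = z (r k)" and "q = p (r k)"
  have eq: "[:1, - l:] * q = [:1, - w:] * q + Polynomial.smult (w - l) ([:0, 1:] * q)"
    by (simp add: algebra_simps smult_diff_left)
  have q0: "N q > 0"
    using zp(2)[of "r k"] nonneg[of "[:1, - w:] * q"] nonneg[of q]
    by (cases "N q = 0") (auto simp: w_def q_def)
  have "d * N q \<le> N ([:1, - w:] * q) + N (Polynomial.smult (w - l) ([:0, 1:] * q))"
    using d(2)[of q] triangle unfolding eq by (meson order_trans)
  also have "N (Polynomial.smult (w - l) ([:0, 1:] * q)) \<le> cmod (w - l) * (N [:0, 1:] * N q)"
    unfolding scale by (intro mult_left_mono submult) auto
  also have "N ([:1, - w:] * q) \<le> inverse (real (Suc (r k))) * N q"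
    using zp(2)[of "r k"] by (simp add: w_def q_def)
  finally have "d * N q \<le> (inverse (real (Suc (r k))) + cmod (w - l) * N [:0, 1:]) * N q"
    by (simp add: algebra_simps)
  then show False
    using k q0 by (simp add: w_def)
qed

end

lemma sum_powers_root_of_unity:
  fixes m j :: nat
  assumes "0 < j" "j < m"
  shows "(\<Sum>k<m. (exp (2 * of_real pi * \<i> * of_nat k / of_nat m) :: complex) ^ j) = 0"
proof -
  define \<omega> :: complex where "\<omega> = exp (2 * of_real pi * \<i> * of_nat j / of_nat m)"
  have w1: "\<omega> \<noteq> 1"
    using assms complex_root_unity_eq_1[of m j] by (auto simp: \<omega>_def dest: nat_dvd_not_less)
  have wm: "\<omega> ^ m = 1"
    using assms complex_root_unity[of m j] by (simp add: \<omega>_def)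
  have "(exp (2 * of_real pi * \<i> * of_nat k / of_nat m)) ^ j = \<omega> ^ k" for k
    by (simp add: \<omega>_def flip: exp_of_nat_mult) (simp add: mult_ac)
  moreover have "(1 - \<omega>) * (\<Sum>k<m. \<omega> ^ k) = 0"
    using one_diff_power_eq[of \<omega> m] wm by simp
  ultimately show ?thesis using w1 by simp
qed

context algebra_seminorm begin

text \<open>
  For \<open>P t = 1 - (t q)\<^sup>m\<close>, partial fractions over the \<open>m\<close>-th roots of unity \<open>\<omega>\<close> represent
  \<open>1 / P t\<close> as the average of the resolvents \<open>1 / (1 - \<omega> t q)\<close>. Under a uniform bound on the
  resolvents, \<open>1 / P v - 1 / P u\<close> is therefore of size proportional to \<open>u - v\<close>, independently
  of \<open>m\<close>. Multiplication by \<open>P u * P v\<close> gives the division-free form below, in which the lower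
  bound \<open>\<delta>\<close> for the factors \<open>1 - z q\<close> plays the part of the resolvent bound.
\<close>

lemma geometric_difference_le:
  fixes u v R \<delta> :: real
  assumes lower: "\<And>z p. cmod z \<le> R \<Longrightarrow> \<delta> * N p \<le> N ([:1, - z:] * p)"
    and \<delta>: "\<delta> > 0" and uv: "0 \<le> v" "v \<le> u" "u \<le> R"
    and small: "(u - v) * N [:0, 1:] \<le> \<delta>\<^sup>2 / 4"
    and m: "m > 0"
  defines "P \<equiv> \<lambda>t. 1 - [:0, complex_of_real t:] ^ m"
  shows "N (P u - P v) \<le> N (P u * P v) / 4"
proof -
  define \<omega> :: "nat \<Rightarrow> complex" where "\<omega> k = exp (2 * of_real pi * \<i> * of_nat k / of_nat m)" for k
  \<comment> \<open>\<open>G t k\<close> is the quotient of \<open>P t\<close> by its factor \<open>1 - \<omega> k t q\<close>.\<close>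
  define G where "G t k = (\<Sum>j<m. [:0, \<omega> k * of_real t:] ^ j)" for t k
  have w: "\<omega> k ^ m = 1" "cmod (\<omega> k) = 1" for k
  proof -
    show "\<omega> k ^ m = 1" using m complex_root_unity[of m k] by (simp add: \<omega>_def)
    show "cmod (\<omega> k) = 1" by (simp add: \<omega>_def)
  qed
  have mono: "[:0, c:] ^ j = monom (c ^ j) j" for c :: complex and j
    using monom_power[of c 1 j] by (simp add: monom_altdef)
  have PG: "P t = [:1, - (\<omega> k * of_real t):] * G t k" for t k
  proof -
    have "[:0, \<omega> k * of_real t:] ^ m = [:0, complex_of_real t:] ^ m"
      by (simp add: mono power_mult_distrib w)
    moreover have "[:1, - (\<omega> k * of_real t):] = 1 - [:0, \<omega> k * of_real t:]"
      by (simp add: one_pCons)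
    ultimately show ?thesis
      unfolding P_def G_def using one_diff_power_eq[of "[:0, \<omega> k * of_real t:]" m] by simp
  qed
  have sumG: "(\<Sum>k<m. G t k) = of_nat m" for t
  proof -
    have "(\<Sum>k<m. G t k) = (\<Sum>j<m. \<Sum>k<m. monom ((\<omega> k * of_real t) ^ j) j)"
      unfolding G_def mono by (rule sum.swap)
    also have "\<dots> = (\<Sum>j<m. monom ((\<Sum>k<m. \<omega> k ^ j) * of_real t ^ j) j)"
      by (simp add: monom_sum power_mult_distrib sum_distrib_right)
    also have "\<dots> = (\<Sum>j<m. if j = 0 then of_nat m else 0)"
      using sum_powers_root_of_unity[of _ m]
      by (intro sum.cong) (auto simp: \<omega>_def monom_0 of_nat_poly)
    finally show ?thesis using m by simp
  qed
  have each: "N (P u * G v k - P v * G u k) \<le> N (P u * P v) / 4" for k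
  proof -
    define H where "H = G u k * G v k"
    have "P u * G v k - P v * G u k = ([:1, - (\<omega> k * of_real u):] - [:1, - (\<omega> k * of_real v):]) * H"
      unfolding H_def by (subst PG[of u k], subst PG[of v k]) (simp only: algebra_simps)
    also have "\<dots> = Polynomial.smult (- \<omega> k * of_real (u - v)) ([:0, 1:] * H)"
      by (simp add: algebra_simps)
    moreover have coef: "cmod (- \<omega> k * of_real (u - v)) = u - v"
      using uv w by (simp add: norm_mult del: of_real_diff)
    ultimately have "N (P u * G v k - P v * G u k) = (u - v) * N ([:0, 1:] * H)"
      using coef by (simp only: scale)
    also have "\<dots> \<le> (u - v) * (N [:0, 1:] * N H)"
      using uv by (intro mult_left_mono submult) auto
    also have "\<dots> \<le> \<delta>\<^sup>2 / 4 * N H"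
      using mult_right_mono[OF small nonneg[of H]] by (simp add: mult.assoc)
    also have "\<dots> \<le> N (P u * P v) / 4"
    proof -
      have "\<delta> * (\<delta> * N H) \<le> \<delta> * N ([:1, - (\<omega> k * of_real v):] * H)"
        using \<delta> uv w by (intro mult_left_mono lower) (auto simp: norm_mult)
      also have "\<dots> \<le> N ([:1, - (\<omega> k * of_real u):] * ([:1, - (\<omega> k * of_real v):] * H))"
        using uv w by (intro lower) (auto simp: norm_mult)
      also have "[:1, - (\<omega> k * of_real u):] * ([:1, - (\<omega> k * of_real v):] * H) = P u * P v"
        unfolding H_def by (subst PG[of u k], subst PG[of v k]) (simp only: mult_ac)
      finally have "\<delta>\<^sup>2 * N H \<le> N (P u * P v)"
        by (simp only: power2_eq_square mult.assoc)
      then show ?thesis by simp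
    qed
    finally show ?thesis .
  qed
  have "Polynomial.smult (of_nat m) (P u - P v) = (\<Sum>k<m. P u * G v k - P v * G u k)"
    by (simp add: sum_subtractf sum_distrib_left[symmetric] sumG of_nat_poly smult_diff_right)
  then have "m * N (P u - P v) = N (\<Sum>k<m. P u * G v k - P v * G u k)"
    using scale[of "of_nat m" "P u - P v"] by simp
  also have "\<dots> \<le> (\<Sum>k<m. N (P u * P v) / 4)"
    by (rule order_trans[OF sum_le]) (intro sum_mono each)
  finally show ?thesis using m by simp
qed

text \<open>
  If \<open>0\<close> is the only approximate eigenvalue, then the spectral radius vanishes. The proof
  walks outwards in \<open>t\<close>: once \<open>(v q)\<^sup>m \<longlonglongrightarrow> 0\<close>, the polynomials \<open>P v\<close> above are close
  to \<open>1\<close>, hence so are the \<open>P u\<close> for \<open>u\<close> slightly larger than \<open>v\<close>, and \<open>(u q)\<^sup>m\<close> stays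
  bounded. The step \<open>u - v\<close> depends only on the lower bound on the disc of radius \<open>t + 1\<close>, so
  finitely many steps reach \<open>t\<close>.
\<close>

lemma quasinilpotent:
  assumes spec: "\<And>\<mu>. approx_eigenvalue \<mu> \<Longrightarrow> \<mu> = 0" and t: "t \<ge> (0::real)"
  shows "(\<lambda>m. t ^ m * N ([:0, 1:] ^ m)) \<longlonglongrightarrow> 0"
proof -
  obtain \<delta> where \<delta>: "\<delta> > 0" "\<And>z p. cmod z \<le> t + 1 \<Longrightarrow> \<delta> * N p \<le> N ([:1, - z:] * p)"
    using uniform_lower_bound[OF spec, of "t + 1"] by auto
  define h where "h = min 1 (\<delta>\<^sup>2 / (4 * (N [:0, 1:] + 1)))"
  have X0: "0 \<le> N [:0, 1:]" by (rule nonneg)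
  have h: "0 < h" "h \<le> 1" using \<delta> X0 by (auto simp: h_def)
  have hX: "h * N [:0, 1:] \<le> \<delta>\<^sup>2 / 4"
  proof -
    have "h * N [:0, 1:] \<le> \<delta>\<^sup>2 / (4 * (N [:0, 1:] + 1)) * N [:0, 1:]"
      using X0 by (intro mult_right_mono) (auto simp: h_def)
    also have "\<dots> \<le> \<delta>\<^sup>2 / 4"
      using X0 by (simp add: field_simps)
    finally show ?thesis .
  qed
  have pw: "N ([:0, complex_of_real s:] ^ m) = s ^ m * N ([:0, 1:] ^ m)" if "s \<ge> 0" for s m
  proof -
    have "[:0, complex_of_real s:] = Polynomial.smult (of_real s) [:0, 1:]" by simp
    then have "[:0, complex_of_real s:] ^ m = Polynomial.smult (of_real s ^ m) ([:0, 1:] ^ m)"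
      by (simp only: smult_power)
    then show ?thesis using that by (simp add: scale norm_power)
  qed
  have step: "(\<lambda>m. w ^ m * N ([:0, 1:] ^ m)) \<longlonglongrightarrow> 0"
    if lim: "(\<lambda>m. v ^ m * N ([:0, 1:] ^ m)) \<longlonglongrightarrow> 0" and v: "0 \<le> v" "v \<le> w" "w \<le> v + h / 2" "w \<le> t" for v w
  proof -
    \<comment> \<open>Each round proves boundedness at \<open>v + h\<close> and then gives up half of the step, since
    convergence to \<open>0\<close> follows from boundedness only strictly below.\<close>
    define u where "u = v + h"
    define P where "P s m = 1 - [:0, complex_of_real s:] ^ m" for s m
    have u: "0 < u" "v \<le> u" "u \<le> t + 1" "w < u" using v h by (auto simp: u_def)
    have "eventually (\<lambda>m. v ^ m * N ([:0, 1:] ^ m) < 1 / 8) sequentially"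
      by (rule order_tendstoD(2)[OF lim]) simp
    then have ev: "eventually (\<lambda>m. u ^ m * N ([:0, 1:] ^ m) \<le> 1) sequentially"
      using eventually_gt_at_top[of 0]
    proof eventually_elim
      case (elim m)
      define y where "y = N ([:0, complex_of_real u:] ^ m)"
      have \<theta>: "N ([:0, complex_of_real v:] ^ m) < 1 / 8" using elim pw v by simp
      have Pu: "N (P u m) \<le> 1 + y"
        unfolding P_def y_def using diff[of 1 "[:0, complex_of_real u:] ^ m"] one by simp
      have Pv: "N (P v m) \<le> 9 / 8"
        unfolding P_def using diff[of 1 "[:0, complex_of_real v:] ^ m"] one \<theta> by simp
      have "y \<le> N ([:0, complex_of_real v:] ^ m) + N (P u m - P v m)"
        unfolding P_def y_def
        using triangle_le_diff[of "[:0, complex_of_real u:] ^ m" "[:0, complex_of_real v:] ^ m"]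
          diff_commute[of "[:0, complex_of_real u:] ^ m" "[:0, complex_of_real v:] ^ m"] by simp
      also have "N (P u m - P v m) \<le> N (P u m * P v m) / 4"
        unfolding P_def
        by (rule geometric_difference_le[where R = "t + 1" and \<delta> = \<delta>])
          (use \<delta> u v hX elim in \<open>auto simp: u_def\<close>)
      also have "N (P u m * P v m) \<le> (1 + y) * (9 / 8)"
        using submult[of "P u m" "P v m"] mult_mono[OF Pu Pv] nonneg[of "P v m"] nonneg y_def
        by (smt (verit))
      finally have "y \<le> N ([:0, complex_of_real v:] ^ m) + (1 + y) * (9 / 8) / 4"
        by simp
      then have "y \<le> 1" using \<theta> by argo
      then show ?case using pw[of u m] u by (simp add: y_def)
    qed
    have up: "eventually (\<lambda>m. w ^ m * N ([:0, 1:] ^ m) \<le> (w / u) ^ m) sequentially"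
      using ev
    proof eventually_elim
      case (elim m)
      have "w ^ m * N ([:0, 1:] ^ m) = (w / u) ^ m * (u ^ m * N ([:0, 1:] ^ m))"
        using u by (simp add: power_divide)
      also have "\<dots> \<le> (w / u) ^ m * 1"
        using elim u v by (intro mult_left_mono) auto
      finally show ?case by simp
    qed
    have "eventually (\<lambda>m. 0 \<le> w ^ m * N ([:0, 1:] ^ m)) sequentially"
      using v nonneg by simp
    moreover have "(\<lambda>m. (w / u) ^ m) \<longlonglongrightarrow> 0"
      using u v by (intro LIMSEQ_realpow_zero) auto
    ultimately show ?thesis
      by (rule real_tendsto_sandwich[OF _ up tendsto_const])
  qed
  have "(\<lambda>m. (min (real i * (h / 2)) t) ^ m * N ([:0, 1:] ^ m)) \<longlonglongrightarrow> 0" for i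
  proof (induction i)
    case 0
    have "eventually (\<lambda>m. 0 = (min (real 0 * (h / 2)) t) ^ m * N ([:0, 1:] ^ m)) sequentially"
      using eventually_gt_at_top[of 0] by eventually_elim (use t in auto)
    then show ?case by (rule Lim_transform_eventually[OF tendsto_const])
  next
    case (Suc i)
    show ?case by (rule step[OF Suc]) (use t h in \<open>auto simp: algebra_simps min_def\<close>)
  qed
  moreover obtain i where "t < real i * (h / 2)"
    using reals_Archimedean3[of "h / 2"] h by auto
  ultimately show ?thesis
    using min.absorb2[of t "real i * (h / 2)"] by (metis less_imp_le)
qed

end

section \<open>The binomial series for an m-th root\<close>

text \<open>
  The coefficient norm is the largest of the seminorms under which the generator has norm at
  most \<open>1\<close>; it serves to bound remainder polynomials without knowing their coefficients.
\<close>

definition l1_norm :: "complex poly \<Rightarrow> real" where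
  "l1_norm p = poly (map_poly cmod p) 1"

lemma l1_norm_0 [simp]: "l1_norm 0 = 0"
  by (simp add: l1_norm_def)

lemma l1_norm_pCons [simp]: "l1_norm (pCons c p) = cmod c + l1_norm p"
  by (simp add: l1_norm_def map_poly_pCons)

lemma l1_norm_nonneg: "0 \<le> l1_norm p"
  by (induction p) auto

lemma l1_norm_add: "l1_norm (p + q) \<le> l1_norm p + l1_norm q"
proof (induction p q rule: poly_induct2)
  case (pCons a p b q)
  then show ?case using norm_triangle_ineq[of a b] by simp
qed simp

lemma l1_norm_smult: "l1_norm (Polynomial.smult c p) = cmod c * l1_norm p"
  by (induction p) (auto simp: norm_mult distrib_left)

lemma l1_norm_mult: "l1_norm (p * q) \<le> l1_norm p * l1_norm q"
proof (induction p)
  case (pCons a p)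
  have "l1_norm (pCons a p * q) \<le> cmod a * l1_norm q + l1_norm (p * q)"
    using l1_norm_add[of "Polynomial.smult a q" "pCons 0 (p * q)"] by (simp add: l1_norm_smult)
  then show ?case using pCons by (simp add: distrib_right)
qed simp

interpretation l1_norm: algebra_seminorm l1_norm
  by unfold_locales
    (simp_all add: l1_norm_add l1_norm_smult l1_norm_mult one_pCons)

lemma fps_power_inject:
  fixes F G :: "'a::field_char_0 fps"
  assumes "F ^ m = G ^ m" "m > 0" "fps_nth F 0 = 1" "fps_nth G 0 = 1"
  shows "F = G"
proof -
  define S where "S = (\<Sum>i<m. G ^ (m - Suc i) * F ^ i)"
  have "fps_nth S 0 = of_nat m"
    using assms by (simp add: S_def fps_sum_nth fps_power_zeroth_eq_one)
  then have "S \<noteq> 0" using assms by auto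
  moreover have "(F - G) * S = 0"
    using power_diff_sumr2[of F m G] assms by (simp add: S_def)
  ultimately show ?thesis by simp
qed

text \<open>
  The formal identity \<open>(1 + Q)\<^bsup>1/m\<^esup> = 1 + X\<close> for \<open>Q = (1 + X)\<^sup>m - 1\<close>: both sides are
  \<open>m\<close>-th roots of \<open>(1 + X)\<^sup>m\<close> with constant coefficient \<open>1\<close>.
\<close>

lemma fps_binomial_root:
  fixes m :: nat
  assumes "m > 0"
  shows "fps_compose (fps_binomial (1 / of_nat m)) ((1 + fps_X) ^ m - 1) = (1 + fps_X :: complex fps)"
proof (rule fps_power_inject[OF _ assms])
  let ?Q = "(1 + fps_X) ^ m - 1 :: complex fps"
  have Q0: "fps_nth ?Q 0 = 0" by (simp add: fps_power_zeroth_eq_one)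
  have "(fps_compose (fps_binomial (1 / of_nat m)) ?Q) ^ m = fps_compose (1 + fps_X) ?Q"
    using assms by (simp add: fps_compose_power[OF Q0] fps_binomial_power fps_binomial_1)
  also have "\<dots> = (1 + fps_X) ^ m"
    using Q0 by (simp add: fps_compose_add_distrib)
  finally show "(fps_compose (fps_binomial (1 / of_nat m)) ?Q) ^ m = (1 + fps_X) ^ m" .
qed auto

text \<open>
  The factor \<open>1 / m\<close>, already present in the linear coefficient, is not lost in the higher ones,
  because each further factor \<open>(1/m - j) / (j + 1)\<close> has modulus at most \<open>1\<close>. It is what makes
  the estimate of the generator tend to \<open>0\<close> as \<open>m\<close> grows.
\<close>

lemma norm_gbinomial_inverse_le:
  assumes "m > 0" "j > 0"
  shows "cmod ((1 / of_nat m) gchoose j) \<le> 1 / real m"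
  using assms(2)
proof (induction j rule: nat_induct_non_zero)
  case 1
  then show ?case by (simp add: norm_divide)
next
  case (Suc j)
  have "1 / of_nat m - of_nat j = complex_of_real (1 / real m - real j)"
    by simp
  then have "cmod (1 / of_nat m - of_nat j) = \<bar>1 / real m - real j\<bar>"
    by (simp only: norm_of_real)
  also have "\<dots> \<le> real (Suc j)"
  proof -
    have "0 < 1 / real m" "1 / real m \<le> 1" using assms(1) by auto
    then show ?thesis by linarith
  qed
  finally have le: "cmod (1 / of_nat m - of_nat j) \<le> real (Suc j)" .
  have "of_nat (Suc j) * ((1 / of_nat m :: complex) gchoose Suc j)
      = (1 / of_nat m - of_nat j) * ((1 / of_nat m) gchoose j)"
    using gbinomial_mult_1[of "1 / of_nat m :: complex" j] by (simp add: algebra_simps)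
  then have "real (Suc j) * cmod ((1 / of_nat m :: complex) gchoose Suc j)
      = cmod (1 / of_nat m - of_nat j) * cmod ((1 / of_nat m) gchoose j)"
    by (metis norm_mult norm_of_nat)
  also have "\<dots> \<le> real (Suc j) * (1 / real m)"
    using le Suc.IH by (intro mult_mono) auto
  finally show ?case
    by (simp only: mult_le_cancel_left_pos of_nat_0_less_iff zero_less_Suc)
qed

text \<open>
  The error made when the binomial series of \<open>(1 + Q)\<^bsup>1/m\<^esup> - 1 = X\<close> is cut off after \<open>J\<close> terms.
\<close>

definition root_remainder :: "nat \<Rightarrow> nat \<Rightarrow> complex poly" where
  "root_remainder m J =
     [:0, 1:] - (\<Sum>j=1..J. Polynomial.smult ((1 / of_nat m) gchoose j) (([:1, 1:] ^ m - 1) ^ j))"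

text \<open>
  The omitted terms of the series are multiples of \<open>Q\<^bsup>J+1\<^esup>\<close>, and \<open>Q\<close> has no constant term.
\<close>

lemma coeff_root_remainder:
  assumes "m > 0" "i \<le> J"
  shows "coeff (root_remainder m J) i = 0"
proof -
  let ?Q = "[:1, 1:] ^ m - 1 :: complex poly"
  let ?c = "\<lambda>j. (1 / of_nat m) gchoose j :: complex"
  have fpsQ: "fps_of_poly ?Q = (1 + fps_X) ^ m - 1"
    by (simp add: fps_of_poly_diff fps_of_poly_power fps_of_poly_pCons)
  have Q0: "fps_nth (fps_of_poly ?Q) 0 = 0"
    unfolding fpsQ by (simp add: fps_power_zeroth_eq_one)
  have "fps_nth (1 + fps_X :: complex fps) i = fps_nth (fps_compose (fps_binomial (1 / of_nat m)) (fps_of_poly ?Q)) i"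
    unfolding fpsQ fps_binomial_root[OF assms(1)] ..
  also have "\<dots> = (\<Sum>j=0..i. ?c j * coeff (?Q ^ j) i)"
    by (simp add: fps_compose_nth flip: fps_of_poly_power)
  also have "\<dots> = (\<Sum>j=0..J. ?c j * coeff (?Q ^ j) i)"
  proof (rule sum.mono_neutral_left)
    show "\<forall>j\<in>{0..J} - {0..i}. ?c j * coeff (?Q ^ j) i = 0"
      using startsby_zero_power_prefix[OF Q0] by (auto simp flip: fps_of_poly_power)
  qed (use assms in auto)
  also have "\<dots> = coeff 1 i + (\<Sum>j=1..J. ?c j * coeff (?Q ^ j) i)"
    by (simp add: sum.atLeast_Suc_atMost)
  finally have "coeff [:0, 1:] i = (\<Sum>j=1..J. ?c j * coeff (?Q ^ j) i)"
    by (cases i) (auto simp: coeff_pCons fps_X_def split: nat.splits)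
  then show ?thesis
    by (simp add: root_remainder_def coeff_sum)
qed

lemma l1_norm_root_remainder:
  assumes "m > 0"
  shows "l1_norm (root_remainder m J) \<le> (2 ^ m + 1) ^ Suc J"
proof -
  let ?Q = "[:1, 1:] ^ m - 1 :: complex poly"
  let ?B = "2 ^ m + 1 :: real"
  have geometric: "1 + (\<Sum>j=1..i. b ^ j) \<le> b ^ Suc i" if "2 \<le> b" for i and b :: real
  proof (induction i)
    case (Suc i)
    have "b ^ Suc i * 2 \<le> b ^ Suc i * b"
      using that by (intro mult_left_mono) auto
    then show ?case using Suc by (simp add: mult_ac)
  qed (use that in simp)
  have Q: "l1_norm ?Q \<le> ?B"
    using l1_norm.diff[of "[:1, 1:] ^ m" 1] l1_norm.power_le[of "[:1, 1:]" m] l1_norm.one by simp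
  have "l1_norm (root_remainder m J)
      \<le> 1 + l1_norm (\<Sum>j=1..J. Polynomial.smult ((1 / of_nat m) gchoose j) (?Q ^ j))"
    unfolding root_remainder_def by (rule order_trans[OF l1_norm.diff]) simp
  also have "\<dots> \<le> 1 + (\<Sum>j=1..J. ?B ^ j)"
  proof (intro add_left_mono order_trans[OF l1_norm.sum_le] sum_mono)
    fix j assume "j \<in> {1..J}"
    then have "cmod ((1 / of_nat m) gchoose j) \<le> 1 / real m"
      using norm_gbinomial_inverse_le[OF assms] by simp
    also have "\<dots> \<le> 1" using assms by simp
    finally have "cmod ((1 / of_nat m) gchoose j) \<le> 1" .
    moreover have "l1_norm (?Q ^ j) \<le> ?B ^ j"
      using l1_norm.power_le[of ?Q j] power_mono[OF Q l1_norm_nonneg, of j] by simp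
    ultimately have "cmod ((1 / of_nat m) gchoose j) * l1_norm (?Q ^ j) \<le> 1 * ?B ^ j"
      by (intro mult_mono) (auto simp: l1_norm_nonneg)
    then show "l1_norm (Polynomial.smult ((1 / of_nat m) gchoose j) (?Q ^ j)) \<le> ?B ^ j"
      by (simp add: l1_norm_smult)
  qed
  also have "\<dots> \<le> ?B ^ Suc J"
    by (rule geometric) simp
  finally show ?thesis .
qed

context algebra_seminorm begin

lemma le_l1_norm:
  assumes "N [:0, 1:] \<le> 1"
  shows "N p \<le> l1_norm p"
proof (induction p)
  case 0
  then show ?case by (simp add: zero)
next
  case (pCons a p)
  have "N (pCons a p) = N (Polynomial.smult a 1 + [:0, 1:] * p)"
    by (simp add: one_pCons)
  also have "\<dots> \<le> cmod a + N [:0, 1:] * N p"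
    using triangle[of "Polynomial.smult a 1" "[:0, 1:] * p"] submult[of "[:0, 1:]" p]
    unfolding scale one by simp
  also have "N [:0, 1:] * N p \<le> 1 * N p"
    using assms nonneg by (rule mult_right_mono)
  finally show ?case using pCons by simp
qed

text \<open>
  A polynomial without low-order terms is small when high powers of the generator are.
\<close>

lemma coeffs_vanish_bound:
  assumes "N [:0, 1:] \<le> 1" "\<And>i. i < j \<Longrightarrow> coeff p i = 0"
  shows "N p \<le> N ([:0, 1:] ^ j) * l1_norm p"
proof -
  have "\<exists>q. p = [:0, 1:] ^ j * q \<and> l1_norm q = l1_norm p"
    using assms(2)
  proof (induction j arbitrary: p)
    case (Suc j)
    obtain a p' where p: "p = pCons a p'" by (cases p)
    have a: "a = 0" using Suc.prems[of 0] p by simp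
    have "coeff p' i = 0" if "i < j" for i
      using Suc.prems[of "Suc i"] that p by simp
    from Suc.IH[OF this] obtain q where "p' = [:0, 1:] ^ j * q" "l1_norm q = l1_norm p'"
      by auto
    then show ?case using a p by (intro exI[of _ q]) simp
  qed simp
  then obtain q where q: "p = [:0, 1:] ^ j * q" "l1_norm q = l1_norm p" by blast
  have "N p \<le> N ([:0, 1:] ^ j) * N q"
    unfolding q(1) by (rule submult)
  also have "\<dots> \<le> N ([:0, 1:] ^ j) * l1_norm q"
    using le_l1_norm[OF assms(1)] nonneg by (rule mult_left_mono)
  finally show ?thesis using q(2) by simp
qed

text \<open>
  Recover \<open>q\<close> from \<open>Q = (1 + q)\<^sup>m - 1\<close> by the binomial series of the \<open>m\<close>-th root. The series is
  dominated by \<open>1 / m\<close> times a geometric series in \<open>r\<close>. The remainder after \<open>J\<close> terms is at most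
  \<open>\<parallel>q\<^bsup>J+1\<^esup>\<parallel>\<close> times a quantity that grows exponentially in \<open>J\<close>, and so vanishes in the limit
  for quasinilpotent \<open>q\<close>. Quasinilpotence is essential here: it selects the principal
  root \<open>1 + q\<close> among all the \<open>m\<close>-th roots of \<open>(1 + q)\<^sup>m\<close>.
\<close>

lemma root_bound:
  assumes X: "N [:0, 1:] \<le> 1"
    and quasi: "\<And>t::real. t \<ge> 0 \<Longrightarrow> (\<lambda>j. t ^ j * N ([:0, 1:] ^ j)) \<longlonglongrightarrow> 0"
    and m: "m > 0" and r: "N ([:1, 1:] ^ m - 1) \<le> r" "r < 1"
  shows "N [:0, 1:] \<le> 1 / (1 - r) / real m"
proof -
  let ?Q = "[:1, 1:] ^ m - 1 :: complex poly"
  let ?B = "2 ^ m + 1 :: real"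
  have r0: "0 \<le> r" using r(1) nonneg[of ?Q] by simp
  have "N [:0, 1:] \<le> 1 / (1 - r) / real m + ?B ^ Suc J * N ([:0, 1:] ^ Suc J)" for J
  proof -
    let ?S = "\<Sum>j=1..J. Polynomial.smult ((1 / of_nat m) gchoose j) (?Q ^ j)"
    have "N ?S \<le> (\<Sum>j=1..J. 1 / real m * r ^ j)"
    proof (intro order_trans[OF sum_le] sum_mono)
      fix j assume "j \<in> {1..J}"
      moreover have "N (?Q ^ j) \<le> r ^ j"
        using power_le[of ?Q j] power_mono[OF r(1) nonneg, of j] by simp
      ultimately show "N (Polynomial.smult ((1 / of_nat m) gchoose j) (?Q ^ j)) \<le> 1 / real m * r ^ j"
        unfolding scale using norm_gbinomial_inverse_le[OF m] nonneg
        by (intro mult_mono) auto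
    qed
    also have "\<dots> \<le> 1 / real m * (\<Sum>j<Suc J. r ^ j)"
      unfolding sum_distrib_left[symmetric] using r0
      by (intro mult_left_mono sum_mono2) auto
    also have "\<dots> \<le> 1 / real m * (1 / (1 - r))"
      using r r0
      by (intro mult_left_mono) (simp_all add: sum_gp_strict divide_right_mono del: sum.lessThan_Suc)
    finally have S: "N ?S \<le> 1 / real m * (1 / (1 - r))" .
    have "N (root_remainder m J) \<le> N ([:0, 1:] ^ Suc J) * l1_norm (root_remainder m J)"
      by (intro coeffs_vanish_bound[OF X] coeff_root_remainder[OF m]) simp
    also have "\<dots> \<le> N ([:0, 1:] ^ Suc J) * ?B ^ Suc J"
      using l1_norm_root_remainder[OF m] nonneg by (rule mult_left_mono)
    finally have "N (root_remainder m J) \<le> N ([:0, 1:] ^ Suc J) * ?B ^ Suc J" .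
    moreover have "N [:0, 1:] \<le> N ?S + N (root_remainder m J)"
      unfolding root_remainder_def by (rule triangle_le_diff)
    ultimately show ?thesis using S by (simp add: mult_ac)
  qed
  then have *: "\<exists>K. \<forall>J\<ge>K. N [:0, 1:] \<le> 1 / (1 - r) / real m + ?B ^ Suc J * N ([:0, 1:] ^ Suc J)"
    by blast
  have "(\<lambda>J. 1 / (1 - r) / real m + ?B ^ Suc J * N ([:0, 1:] ^ Suc J)) \<longlonglongrightarrow> 1 / (1 - r) / real m + 0"
    by (intro tendsto_add tendsto_const LIMSEQ_Suc[OF quasi]) simp
  from LIMSEQ_le_const[OF this *] show ?thesis by simp
qed

lemma generator_null:
  fixes n :: "nat \<Rightarrow> nat"
  assumes n: "strict_mono n" "n 0 = 1"
    and r: "r < 1" "\<And>k. N ([:1, 1:] ^ n k - 1) \<le> r"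
    and scalars: "\<And>z::complex. (\<And>k. cmod (z ^ n k - 1) \<le> r) \<Longrightarrow> z = 1"
  shows "N [:0, 1:] = 0"
proof -
  have pos: "n k > 0" for k
    using n strict_mono_less_eq[OF n(1), of 0 k] by simp
  have X: "N [:0, 1:] \<le> 1"
    using r(2)[of 0] r(1) n(2) by (simp add: one_pCons)
  have spec: "\<mu> = 0" if "approx_eigenvalue \<mu>" for \<mu>
  proof -
    have "cmod ((1 + \<mu>) ^ n k - 1) \<le> r" for k
      using approx_eigenvalue_bound[OF that, of "n k"] r(2)[of k] by simp
    from scalars[OF this] show ?thesis by simp
  qed
  have "N [:0, 1:] \<le> 1 / (1 - r) / real (n k)" for k
    by (rule root_bound[OF X quasinilpotent[OF spec] pos r(2) r(1)])
  moreover have "(\<lambda>k. 1 / (1 - r) / real (n k)) \<longlonglongrightarrow> 0"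
    by (rule real_tendsto_divide_at_top[OF tendsto_const
        filterlim_compose[OF filterlim_real_sequentially filterlim_subseq[OF n(1)]]])
  ultimately have "N [:0, 1:] \<le> 0"
    by (intro LIMSEQ_le_const) auto
  then show ?thesis using nonneg[of "[:0, 1:]"] by simp
qed

end

text \<open>
  The bound \<open>r\<close> strictly below \<open>e\<close> keeps what a pointwise strict inequality would lose.
\<close>

section \<open>From polynomials to normed algebras\<close>

lemma SUP_ereal_less_iff:
  fixes f :: "nat \<Rightarrow> real"
  shows "(SUP k. ereal (f k)) < ereal e \<longleftrightarrow> (\<exists>r<e. \<forall>k. f k \<le> r)"
proof
  assume "(SUP k. ereal (f k)) < ereal e"
  then obtain r where r: "(SUP k. ereal (f k)) < ereal r" "ereal r < ereal e"
    using ereal_dense2 by blast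
  have "f k \<le> r" for k
  proof -
    have "ereal (f k) \<le> (SUP k. ereal (f k))" by (rule SUP_upper) simp
    then have "ereal (f k) < ereal r" using r(1) by (rule le_less_trans)
    then show ?thesis by simp
  qed
  then show "\<exists>r<e. \<forall>k. f k \<le> r" using r(2) by auto
next
  assume "\<exists>r<e. \<forall>k. f k \<le> r"
  then obtain r where r: "r < e" "\<And>k. f k \<le> r" by blast
  have "(SUP k. ereal (f k)) \<le> ereal r" using r(2) by (intro SUP_least) simp
  also have "\<dots> < ereal e" using r(1) by simp
  finally show "(SUP k. ereal (f k)) < ereal e" .
qed

context complex_normed_algebra
begin

text \<open>
  The locale contains two rings, the algebra and its scalars; the rules for the
  algebra are collected under a name that cannot be taken for those of the scalars.
\<close>

lemma ring_algebra: "ring A"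
  by (rule complex_normed_algebra.axioms(1)[OF complex_normed_algebra_axioms])

lemmas ring_rules = ring.ring_simprules[OF ring_algebra]

lemma NSS_iff:
  assumes "\<epsilon> > 0"
  shows "NSS A n \<epsilon> \<longleftrightarrow>
    (\<forall>a\<in>carrier A. (\<exists>r<\<epsilon>. \<forall>k. alg_norm A (a [^] n k \<ominus> \<one>) \<le> r) \<longrightarrow> a = \<one>)"
proof -
  have "\<exists>r<\<epsilon>. \<forall>k. alg_norm A (\<one> [^] n k \<ominus> \<one>) \<le> r"
    using assms norm_eq_zero_iff[of \<zero>] by (intro exI[of _ 0]) (simp add: ring_rules)
  then show ?thesis
    unfolding NSS_def SUP_ereal_less_iff by auto
qed

lemma scalar_closed [simp]: "x \<in> carrier A \<Longrightarrow> c \<odot>\<^bsub>A\<^esub> x \<in> carrier A"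
  using smult_closed[of c x] by (simp add: complex_ring_def)

lemma scalar_add: "x \<in> carrier A \<Longrightarrow> (c + d) \<odot>\<^bsub>A\<^esub> x = c \<odot>\<^bsub>A\<^esub> x \<oplus> d \<odot>\<^bsub>A\<^esub> x"
  using smult_l_distr[of c d x] by (simp add: complex_ring_def)

lemma scalar_mult: "x \<in> carrier A \<Longrightarrow> (c * d) \<odot>\<^bsub>A\<^esub> x = c \<odot>\<^bsub>A\<^esub> (d \<odot>\<^bsub>A\<^esub> x)"
  using smult_assoc1[of c d x] by (simp add: complex_ring_def)

lemma scalar_distrib:
  "x \<in> carrier A \<Longrightarrow> y \<in> carrier A \<Longrightarrow> c \<odot>\<^bsub>A\<^esub> (x \<oplus> y) = c \<odot>\<^bsub>A\<^esub> x \<oplus> c \<odot>\<^bsub>A\<^esub> y"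
  using smult_r_distr[of c x y] by (simp add: complex_ring_def)

lemma scalar_one [simp]: "x \<in> carrier A \<Longrightarrow> 1 \<odot>\<^bsub>A\<^esub> x = x"
  using smult_one[of x] by (simp add: complex_ring_def)

lemma scalar_0 [simp]: "x \<in> carrier A \<Longrightarrow> 0 \<odot>\<^bsub>A\<^esub> x = \<zero>"
  using smult_l_null[of x] by (simp add: complex_ring_def)

lemma scalar_zero [simp]: "c \<odot>\<^bsub>A\<^esub> \<zero> = \<zero>"
  using smult_r_null[of c] by (simp add: complex_ring_def)

text \<open>
  Horner's scheme. Each step multiplies by \<open>q\<close> on the left, so that multiplicativity follows by
  induction on the left factor even in a noncommutative algebra.
\<close>

definition evaluate :: "'a \<Rightarrow> complex poly \<Rightarrow> 'a" where
  "evaluate q p = fold_coeffs (\<lambda>c x. c \<odot>\<^bsub>A\<^esub> \<one> \<oplus> q \<otimes> x) p \<zero>"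

lemma evaluate_0 [simp]: "evaluate q 0 = \<zero>"
  by (simp add: evaluate_def)

lemma evaluate_pCons:
  assumes "q \<in> carrier A"
  shows "evaluate q (pCons c p) = c \<odot>\<^bsub>A\<^esub> \<one> \<oplus> q \<otimes> evaluate q p"
  using assms by (cases "c = 0"; cases "p = 0") (simp_all add: evaluate_def)

lemma evaluate_closed [simp]: "q \<in> carrier A \<Longrightarrow> evaluate q p \<in> carrier A"
  by (induction p) (simp_all add: evaluate_pCons)

lemma evaluate_1 [simp]: "q \<in> carrier A \<Longrightarrow> evaluate q 1 = \<one>"
  by (simp add: one_pCons evaluate_pCons)

lemma evaluate_X: "q \<in> carrier A \<Longrightarrow> evaluate q [:0, 1:] = q"
  by (simp add: evaluate_pCons)

lemma evaluate_add:
  assumes q: "q \<in> carrier A"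
  shows "evaluate q (p + p') = evaluate q p \<oplus> evaluate q p'"
proof (induction p p' rule: poly_induct2)
  case (pCons a p b p')
  then show ?case
    using q by (simp add: evaluate_pCons scalar_add ring_rules)
qed simp

lemma evaluate_smult:
  assumes q: "q \<in> carrier A"
  shows "evaluate q (Polynomial.smult c p) = c \<odot>\<^bsub>A\<^esub> evaluate q p"
  by (induction p)
    (use q in \<open>simp_all add: evaluate_pCons scalar_distrib scalar_mult smult_mult_right\<close>)

lemma evaluate_mult:
  assumes q: "q \<in> carrier A"
  shows "evaluate q (p * p') = evaluate q p \<otimes> evaluate q p'"
proof (induction p)
  case (pCons a p)
  then show ?case
    using q
    by (simp add: evaluate_add evaluate_smult evaluate_pCons smult_mult_left ring_rules)
qed (use q in simp)

lemma evaluate_power: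
  assumes q: "q \<in> carrier A"
  shows "evaluate q (p ^ m) = evaluate q p [^] m"
proof (induction m)
  case (Suc m)
  have "evaluate q (p ^ Suc m) = evaluate q (p ^ m * p)"
    by (simp only: power_Suc mult.commute)
  then show ?case using Suc q by (simp add: evaluate_mult)
qed (use q in simp)

lemma evaluate_diff:
  assumes q: "q \<in> carrier A"
  shows "evaluate q (p - p') = evaluate q p \<ominus> evaluate q p'"
proof -
  have closed: "evaluate q (p - p') \<in> carrier A" "evaluate q p' \<in> carrier A"
    using q by simp_all
  have "evaluate q p = evaluate q (p - p') \<oplus> evaluate q p'"
    by (simp add: evaluate_add[OF q, symmetric])
  then have "evaluate q p \<ominus> evaluate q p'
      = evaluate q (p - p') \<oplus> (evaluate q p' \<oplus> \<ominus> evaluate q p')"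
    unfolding a_minus_def by (simp only:) (rule ring_rules; use closed in \<open>simp add: ring_rules\<close>)
  then show ?thesis
    using closed by (simp add: ring_rules)
qed

lemma algebra_seminorm_evaluate:
  assumes "q \<in> carrier A"
  shows "algebra_seminorm (\<lambda>p. alg_norm A (evaluate q p))"
  by unfold_locales
    (use assms in \<open>simp_all add: evaluate_add evaluate_smult evaluate_mult
      norm_triangle norm_smult norm_submult norm_unit\<close>)

text \<open>
  The seminorm \<open>p \<mapsto> \<parallel>p(a - e)\<parallel>\<close> annihilates the generator, that is, \<open>a - e = 0\<close>.
\<close>

lemma eq_one_if_powers_near_one:
  fixes n :: "nat \<Rightarrow> nat"
  assumes n: "strict_mono n" "n 0 = 1"
    and a: "a \<in> carrier A"
    and r: "r < 1" "\<And>k. alg_norm A (a [^] n k \<ominus> \<one>) \<le> r"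
    and scalars: "\<And>z::complex. (\<And>k. cmod (z ^ n k - 1) \<le> r) \<Longrightarrow> z = 1"
  shows "a = \<one>"
proof -
  define q where "q = a \<ominus> \<one>"
  have q: "q \<in> carrier A" using a by (simp add: q_def)
  interpret N: algebra_seminorm "\<lambda>p. alg_norm A (evaluate q p)"
    using q by (rule algebra_seminorm_evaluate)
  have a_eq: "evaluate q [:1, 1:] = a"
    using a q by (simp add: evaluate_pCons) (simp add: q_def ring_rules)
  then have "alg_norm A (evaluate q ([:1, 1:] ^ n k - 1)) \<le> r" for k
    using r(2)[of k] q by (simp add: evaluate_diff evaluate_power)
  then have "alg_norm A (evaluate q [:0, 1:]) = 0"
    by (rule N.generator_null[OF n r(1) _ scalars])
  then have "q = \<zero>"
    using q by (simp add: evaluate_X norm_eq_zero_iff)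
  then show ?thesis
    using a_eq by (simp add: evaluate_pCons ring_rules)
qed

end

section \<open>Complex numbers inside an arbitrary universe\<close>

text \<open>
  The complex field carried over to the range of an injection \<open>f\<close>. Instantiating the universal
  statement over algebras in \<open>'a\<close> with it yields the statement about the field itself, and
  \<open>f = id\<close> gives the field in its original form.
\<close>

definition complex_copy :: "(complex \<Rightarrow> 'a) \<Rightarrow> 'a normed_algebra" where
  "complex_copy f =
     \<lparr>carrier = range f, mult = (\<lambda>x y. f (inv_into UNIV f x * inv_into UNIV f y)), one = f 1,
      zero = f 0, add = (\<lambda>x y. f (inv_into UNIV f x + inv_into UNIV f y)),
      smult = (\<lambda>c x. f (c * inv_into UNIV f x)), alg_norm = (\<lambda>x. cmod (inv_into UNIV f x))\<rparr>"

lemma complex_algebra_eq_copy: "complex_algebra = complex_copy id"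
  by (simp add: complex_algebra_def complex_copy_def fun_eq_iff)

lemma complex_normed_algebra_copy:
  assumes f: "inj f"
  shows "complex_normed_algebra (complex_copy f)"
proof -
  note [simp] = complex_copy_def inv_f_f[OF f] inj_eq[OF f]
  have ab: "abelian_group (complex_copy f)"
    by (rule abelian_groupI) (auto simp: algebra_simps intro: exI[of _ "- x" for x])
  have rg: "ring (complex_copy f)"
    by (rule ringI[OF ab]; (rule monoidI)?) (auto simp: algebra_simps)
  have md: "Module.module complex_ring (complex_copy f)"
    by (rule moduleI[OF cring_complex_ring ab]) (auto simp: complex_ring_def algebra_simps)
  show ?thesis
    by (intro complex_normed_algebra.intro rg md complex_normed_algebra_axioms.intro)
       (auto simp: norm_mult norm_triangle_ineq)
qed

lemma NSS_copy_iff: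
  assumes f: "inj f" and \<epsilon>: "\<epsilon> > 0"
  shows "NSS (complex_copy f) n \<epsilon> \<longleftrightarrow>
    (\<forall>z. (\<exists>r<\<epsilon>. \<forall>k. cmod (z ^ n k - 1) \<le> r) \<longrightarrow> z = 1)"
proof -
  interpret C: complex_normed_algebra "complex_copy f"
    using f by (rule complex_normed_algebra_copy)
  note [simp] = inv_f_f[OF f] inj_eq[OF f]
  have carrier: "carrier (complex_copy f) = range f"
    and one: "\<one>\<^bsub>complex_copy f\<^esub> = f 1" and zero: "\<zero>\<^bsub>complex_copy f\<^esub> = f 0"
    and norm: "alg_norm (complex_copy f) (f z) = cmod z"
    and mult: "f z \<otimes>\<^bsub>complex_copy f\<^esub> f w = f (z * w)"
    and add: "f z \<oplus>\<^bsub>complex_copy f\<^esub> f w = f (z + w)" for z w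
    by (simp_all add: complex_copy_def)
  have pow: "f z [^]\<^bsub>complex_copy f\<^esub> m = f (z ^ m)" for z and m :: nat
    by (induction m) (simp_all add: one mult mult.commute)
  have neg: "\<ominus>\<^bsub>complex_copy f\<^esub> f z = f (- z)" for z
    by (rule abelian_group.minus_equality[OF ring.is_abelian_group[OF C.ring_algebra]])
      (simp_all add: carrier add zero)
  have diff: "f z \<ominus>\<^bsub>complex_copy f\<^esub> f w = f (z - w)" for z w
    by (simp add: a_minus_def neg add)
  show ?thesis
    unfolding C.NSS_iff[OF \<epsilon>] by (simp add: carrier one pow diff norm)
qed

lemma Jamison_pair_iff:
  "Jamison_pair n \<epsilon> \<longleftrightarrow>
    (\<forall>z. cmod z = 1 \<longrightarrow> (\<exists>r<\<epsilon>. \<forall>k. cmod (z ^ n k - 1) \<le> r) \<longrightarrow> z = 1)"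
  unfolding Jamison_pair_def not_less[symmetric] SUP_ereal_less_iff by blast

text \<open>
  Inside the disc the powers tend to \<open>0\<close>, at distance \<open>1\<close> from \<open>1\<close>; outside they are unbounded.
\<close>

lemma norm_one_of_powers_near_one:
  fixes z :: complex and n :: "nat \<Rightarrow> nat"
  assumes n: "strict_mono n" and r: "r < 1" "\<And>k. cmod (z ^ n k - 1) \<le> r"
  shows "cmod z = 1"
proof (rule ccontr)
  assume "cmod z \<noteq> 1"
  then consider "cmod z < 1" | "cmod z > 1" by linarith
  then show False
  proof cases
    case 1
    have "(\<lambda>k. z ^ n k) \<longlonglongrightarrow> 0"
      using LIMSEQ_subseq_LIMSEQ[OF LIMSEQ_power_zero[OF 1] n] by (simp add: o_def)
    then have "(\<lambda>k. cmod (z ^ n k - 1)) \<longlonglongrightarrow> cmod (0 - 1)"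
      by (intro tendsto_intros)
    then have "cmod (0 - 1) \<le> r"
      by (rule LIMSEQ_le_const2) (use r(2) in blast)
    then show False using r(1) by simp
  next
    case 2
    obtain m where m: "2 < cmod z ^ m" using real_arch_pow[OF 2] by blast
    have "cmod z ^ m \<le> cmod z ^ n m"
      using 2 seq_suble[OF n] by (intro power_increasing) auto
    moreover have "cmod z ^ n m \<le> cmod (z ^ n m - 1) + 1"
      using norm_triangle_ineq[of "z ^ n m - 1" 1] by (simp add: norm_power)
    ultimately show False using m r(1) r(2)[of m] by linarith
  qed
qed

theorem theorem2p4:
  fixes n :: "nat \<Rightarrow> nat" and \<epsilon> :: real
  assumes "\<epsilon> > 0"
    and "strict_mono n" and "\<And>k. n k > 0" and "n 0 = 1"
    and universe: "\<exists>f :: complex \<Rightarrow> 'a. inj f"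
  shows "(all_complex_NSS TYPE('a) n \<epsilon> \<longleftrightarrow> NSS complex_algebra n \<epsilon>) \<and>
         (NSS complex_algebra n \<epsilon> \<longleftrightarrow> Jamison_pair n \<epsilon> \<and> \<epsilon> \<le> 1)"
proof -
  have complex: "NSS complex_algebra n \<epsilon> \<longleftrightarrow>
      (\<forall>z. (\<exists>r<\<epsilon>. \<forall>k. cmod (z ^ n k - 1) \<le> r) \<longrightarrow> z = 1)"
    unfolding complex_algebra_eq_copy by (rule NSS_copy_iff[OF _ assms(1)]) simp
  have le_1: "\<epsilon> \<le> 1" if "NSS complex_algebra n \<epsilon>"
  proof (rule ccontr)
    assume "\<not> \<epsilon> \<le> 1"
    \<comment> \<open>The element \<open>0\<close> has all its powers at distance exactly \<open>1\<close> from \<open>1\<close>.\<close>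
    then have "\<exists>r<\<epsilon>. \<forall>k. cmod (0 ^ n k - 1) \<le> r"
      using assms(3) by (intro exI[of _ 1]) (simp add: zero_power)
    then show False using that complex by (metis zero_neq_one)
  qed
  have "NSS complex_algebra n \<epsilon> \<longleftrightarrow> Jamison_pair n \<epsilon> \<and> \<epsilon> \<le> 1"
    using le_1 norm_one_of_powers_near_one[OF assms(2)]
    unfolding complex Jamison_pair_iff by (meson less_le_trans)
  moreover have "NSS complex_algebra n \<epsilon>" if all: "all_complex_NSS TYPE('a) n \<epsilon>"
  proof -
    obtain f :: "complex \<Rightarrow> 'a" where f: "inj f" using universe by blast
    have "NSS (complex_copy f) n \<epsilon>"
      using all complex_normed_algebra_copy[OF f] by (simp add: all_complex_NSS_def)
    then show ?thesis
      unfolding complex NSS_copy_iff[OF f assms(1)] .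
  qed
  moreover have "all_complex_NSS TYPE('a) n \<epsilon>" if C: "NSS complex_algebra n \<epsilon>"
    unfolding all_complex_NSS_def
  proof (intro allI impI)
    fix A :: "'a normed_algebra"
    assume "complex_normed_algebra A"
    then interpret complex_normed_algebra A .
    show "NSS A n \<epsilon>"
      unfolding NSS_iff[OF assms(1)]
    proof (intro ballI impI, elim exE conjE)
      fix a r
      assume a: "a \<in> carrier A" and r: "r < \<epsilon>" "\<forall>k. alg_norm A (a [^]\<^bsub>A\<^esub> n k \<ominus>\<^bsub>A\<^esub> \<one>\<^bsub>A\<^esub>) \<le> r"
      show "a = \<one>\<^bsub>A\<^esub>"
        by (rule eq_one_if_powers_near_one[OF assms(2,4) a, of r]) (use r le_1[OF C] C complex in auto)
    qed
  qed
  ultimately show ?thesis by blast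
qed

end
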